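(* Let $H$ be a left quaternionic Hilbert space with inner product $(\cdot,\cdot)$ and let $\mathcal{T}:H\to H$ be a compact normal (bounded left $\mathbb{H}$-linear) operator. Then there are a (possibly finite) sequence $\{\lambda_k\}$ of quaternions satisfying $|\lambda_1|\geq|\lambda_2|\geq\cdots$ and a sequence $\{\xi_k\}\subset U(H)$, indexed by the same set, such that: 1. the $\lambda_k$ are eigenvalues of $\mathcal{T}$, and $|\lambda_k|\to 0$ if $\{\lambda_k\}$ is infinite; 2. $\mathcal{T}\xi_k=\lambda_k\xi_k$ and $\mathcal{K}\xi_k=|\lambda_k|^2\xi_k$ for every $k$, where $\mathcal{K}=\mathcal{T}\mathcal{T}^*$; and for every $u\in H$, $$\mathcal{T}u=\sum_{k} (u,\xi_k)\lambda_k\xi_k\qquad\text{and}\qquad \mathcal{K}u=\sum_{k} (u,\xi_k)|\lambda_k|^2\xi_k,$$ the sums being over all indices $k$ of the sequence; 3. if $0$ is not an eigenvalue of $\mathcal{T}$, then $\{\xi_k\}$ is an orthonormal basis of $H$.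
   Context: $\mathbb{H}$ denotes the skew field of (Hamilton) quaternions, with conjugation $q\mapsto\overline{q}$ and norm $|q|$, $|q|^2=q\overline{q}$. A left quaternionic Hilbert space $H$ is a left $\mathbb{H}$-module with an inner product $(\cdot,\cdot):H\times H\to\mathbb{H}$ satisfying $(u,v)=\overline{(v,u)}$, $(pu+qv,w)=p(u,w)+q(v,w)$ (hence $(u,pv+qw)=(u,v)\overline{p}+(u,w)\overline{q}$), $(u,u)\geq 0$ real with $(u,u)=0$ iff $u=0$, for $p,q\in\mathbb{H}$, $u,v,w\in H$, and which is complete for the norm $\|u\|=(u,u)^{1/2}$. $U(H)=\{u\in H:\|u\|=1\}$. An operator is left $\mathbb{H}$-linear if $\mathcal{T}(pu+qv)=p\mathcal{T}u+q\mathcal{T}v$; it is bounded if $\|\mathcal{T}u\|\le c\|u\|$ for some constant $c$ and all $u$. The adjoint $\mathcal{T}^*$ of a bounded left $\mathbb{H}$-linear operator is the unique bounded left $\mathbb{H}$-linear operator with $(\mathcal{T}u,v)=(u,\mathcal{T}^*v)$ for all $u,v\in H$. $\mathcal{T}$ is normal if $\mathcal{T}\mathcal{T}^*=\mathcal{T}^*\mathcal{T}$, and compact if $\overline{\mathcal{T}(B)}$ is compact for every bounded $B\subset H$. A quaternion $q$ is an eigenvalue of $\mathcal{T}$ if $\mathcal{T}u=qu$ for some $u\in H\setminus\{0\}$. An orthonormal basis is an orthonormal set whose left $\mathbb{H}$-linear span is dense in $H$. *)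

theory Defs
  imports "HOL-Analysis.Analysis" "HOL-Library.Extended_Nat"
begin

section \<open>The skew field of quaternions\<close>

datatype quat = Quat (qre: real) (qi: real) (qj: real) (qk: real)

lemma quat_eq_iff: "p = q \<longleftrightarrow> qre p = qre q \<and> qi p = qi q \<and> qj p = qj q \<and> qk p = qk q"
  by (cases p; cases q) simp

definition qcnj :: "quat \<Rightarrow> quat" where
  "qcnj q = Quat (qre q) (- qi q) (- qj q) (- qk q)"

lemma qcnj_sel [simp]:
  "qre (qcnj q) = qre q" "qi (qcnj q) = - qi q" "qj (qcnj q) = - qj q" "qk (qcnj q) = - qk q"
  by (simp_all add: qcnj_def)

instantiation quat :: ab_group_add
begin

definition "0 = Quat 0 0 0 0"
definition "p + q = Quat (qre p + qre q) (qi p + qi q) (qj p + qj q) (qk p + qk q)"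
definition "- q = Quat (- qre q) (- qi q) (- qj q) (- qk q)"
definition "p - q = Quat (qre p - qre q) (qi p - qi q) (qj p - qj q) (qk p - qk q)"

instance
  by standard
    (simp_all add: quat_eq_iff zero_quat_def plus_quat_def uminus_quat_def minus_quat_def)

end

lemma quat_add_sel [simp]:
  "qre 0 = 0" "qi 0 = 0" "qj 0 = 0" "qk 0 = 0"
  "qre (p + q) = qre p + qre q" "qi (p + q) = qi p + qi q"
  "qj (p + q) = qj p + qj q" "qk (p + q) = qk p + qk q"
  "qre (- q) = - qre q" "qi (- q) = - qi q" "qj (- q) = - qj q" "qk (- q) = - qk q"
  "qre (p - q) = qre p - qre q" "qi (p - q) = qi p - qi q"
  "qj (p - q) = qj p - qj q" "qk (p - q) = qk p - qk q"
  by (simp_all add: zero_quat_def plus_quat_def uminus_quat_def minus_quat_def)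

instantiation quat :: real_algebra_1
begin

definition "1 = Quat 1 0 0 0"

definition "p * q = Quat
  (qre p * qre q - qi p * qi q - qj p * qj q - qk p * qk q)
  (qre p * qi q + qi p * qre q + qj p * qk q - qk p * qj q)
  (qre p * qj q - qi p * qk q + qj p * qre q + qk p * qi q)
  (qre p * qk q + qi p * qj q - qj p * qi q + qk p * qre q)"

definition "scaleR r q = Quat (r * qre q) (r * qi q) (r * qj q) (r * qk q)"

instance
  by standard
    (simp_all add: quat_eq_iff one_quat_def times_quat_def scaleR_quat_def algebra_simps)

end

lemma quat_mult_sel [simp]:
  "qre 1 = 1" "qi 1 = 0" "qj 1 = 0" "qk 1 = 0"
  "qre (p * q) = qre p * qre q - qi p * qi q - qj p * qj q - qk p * qk q"
  "qi (p * q) = qre p * qi q + qi p * qre q + qj p * qk q - qk p * qj q"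
  "qj (p * q) = qre p * qj q - qi p * qk q + qj p * qre q + qk p * qi q"
  "qk (p * q) = qre p * qk q + qi p * qj q - qj p * qi q + qk p * qre q"
  "qre (scaleR r q) = r * qre q" "qi (scaleR r q) = r * qi q"
  "qj (scaleR r q) = r * qj q" "qk (scaleR r q) = r * qk q"
  by (simp_all add: one_quat_def times_quat_def scaleR_quat_def)

lemma quat_of_real_sel [simp]:
  "qre (of_real r) = r" "qi (of_real r) = 0" "qj (of_real r) = 0" "qk (of_real r) = 0"
  by (simp_all add: of_real_def)

instantiation quat :: real_normed_div_algebra
begin

definition norm_quat :: "quat \<Rightarrow> real" where
  "norm q = sqrt ((qre q)\<^sup>2 + (qi q)\<^sup>2 + (qj q)\<^sup>2 + (qk q)\<^sup>2)"

definition "sgn (q::quat) = q /\<^sub>R norm q"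
definition "dist (p::quat) q = norm (p - q)"
definition [code del]:
  "(uniformity :: (quat \<times> quat) filter) = (INF e\<in>{0<..}. principal {(x, y). dist x y < e})"
definition [code del]:
  "open (U :: quat set) \<longleftrightarrow> (\<forall>x\<in>U. \<forall>\<^sub>F (x', y) in uniformity. x' = x \<longrightarrow> y \<in> U)"
definition "inverse (q::quat) = qcnj q /\<^sub>R (norm q)\<^sup>2"
definition "p div (q::quat) = p * inverse q"

lemma quat_norm_sq: "(norm (q::quat))\<^sup>2 = (qre q)\<^sup>2 + (qi q)\<^sup>2 + (qj q)\<^sup>2 + (qk q)\<^sup>2"
  by (simp add: norm_quat_def)

lemma quat_norm_sq_eq_0: "(norm (q::quat))\<^sup>2 = 0 \<longleftrightarrow> q = 0"
  by (simp add: quat_norm_sq quat_eq_iff add_nonneg_eq_0_iff)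

lemma quat_norm_pairs: "norm q = norm ((qre q, qi q), (qj q, qk q))"
  by (simp add: norm_quat_def norm_Pair)

instance
proof
  fix p q :: quat and r :: real
  show "norm q = 0 \<longleftrightarrow> q = 0"
    using quat_norm_sq_eq_0 [of q] by simp
  show "norm (p + q) \<le> norm p + norm q"
    using norm_triangle_ineq
      [of "((qre p, qi p), (qj p, qk p))" "((qre q, qi q), (qj q, qk q))"]
    by (simp add: quat_norm_pairs)
  show "norm (r *\<^sub>R q) = \<bar>r\<bar> * norm q"
    by (simp add: norm_quat_def power_mult_distrib flip: distrib_left real_sqrt_abs real_sqrt_mult)
  show "norm (p * q) = norm p * norm q"
    unfolding norm_quat_def real_sqrt_mult [symmetric]
    by (rule arg_cong [of _ _ sqrt]) (simp add: power2_eq_square algebra_simps)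
  show "q \<noteq> 0 \<Longrightarrow> inverse q * q = 1"
    using quat_norm_sq_eq_0 [of q]
    by (simp add: quat_eq_iff inverse_quat_def quat_norm_sq)
       (simp add: field_simps power2_eq_square)
  show "q \<noteq> 0 \<Longrightarrow> q * inverse q = 1"
    using quat_norm_sq_eq_0 [of q]
    by (simp add: quat_eq_iff inverse_quat_def quat_norm_sq)
       (simp add: field_simps power2_eq_square)
  show "inverse (0::quat) = 0"
    by (simp add: inverse_quat_def quat_eq_iff)
qed (simp_all add: sgn_quat_def dist_quat_def uniformity_quat_def open_quat_def divide_quat_def)

end

lemma quat_mult_cnj: "q * qcnj q = of_real ((norm q)\<^sup>2)"
  by (simp add: quat_eq_iff quat_norm_sq) (simp add: power2_eq_square)


section \<open>Left quaternionic Hilbert spaces\<close>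

class scaleQ = scaleR +
  fixes scaleQ :: "quat \<Rightarrow> 'a \<Rightarrow> 'a" (infixr \<open>*\<^sub>Q\<close> 75)
  assumes scaleR_scaleQ: "scaleR r = scaleQ (of_real r)"

class quat_vector = scaleQ + ab_group_add +
  assumes scaleQ_add_right: "p *\<^sub>Q (u + v) = p *\<^sub>Q u + p *\<^sub>Q v"
    and scaleQ_add_left: "(p + q) *\<^sub>Q u = p *\<^sub>Q u + q *\<^sub>Q u"
    and scaleQ_scaleQ: "p *\<^sub>Q q *\<^sub>Q u = (p * q) *\<^sub>Q u"
    and scaleQ_one: "1 *\<^sub>Q u = u"

lemma (in quat_vector) scaleQ_zero_left: "0 *\<^sub>Q u = 0"
  using scaleQ_add_left [of 0 0 u] by simp

subclass (in quat_vector) real_vector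
  by standard
    (simp_all add: scaleR_scaleQ scaleQ_add_right scaleQ_add_left scaleQ_scaleQ scaleQ_one)

class quat_preinner = quat_vector +
  fixes qinner :: "'a \<Rightarrow> 'a \<Rightarrow> quat"
  assumes qinner_commute: "qinner u v = qcnj (qinner v u)"
    and qinner_left: "qinner (p *\<^sub>Q u + q *\<^sub>Q v) w = p * qinner u w + q * qinner v w"
    and qinner_self_real: "qinner u u \<in> \<real>"
    and qinner_self_ge_0: "0 \<le> qre (qinner u u)"
    and qinner_self_eq_0: "qinner u u = 0 \<longleftrightarrow> u = 0"
begin

definition qnorm :: "'a \<Rightarrow> real" where
  "qnorm u = sqrt (qre (qinner u u))"

lemma qinner_add_left: "qinner (u + v) w = qinner u w + qinner v w"
  using qinner_left [of 1 u 1 v w] by (simp add: scaleQ_one)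

lemma qinner_zero_left: "qinner 0 w = 0"
  using qinner_add_left [of 0 0 w] by simp

lemma qre_qinner_commute: "qre (qinner u v) = qre (qinner v u)"
  by (subst qinner_commute) simp

lemma qre_qinner_left:
  "qre (qinner (scaleR a u + scaleR b v) w) = a * qre (qinner u w) + b * qre (qinner v w)"
  by (simp add: scaleR_scaleQ qinner_left)

lemma qre_qinner_combination:
  "qre (qinner (scaleR a u + scaleR b v) (scaleR a u + scaleR b v)) =
    a\<^sup>2 * qre (qinner u u) + 2 * a * b * qre (qinner u v) + b\<^sup>2 * qre (qinner v v)"
  (is "qre (qinner ?w ?w) = _")
proof -
  have "qre (qinner u ?w) = a * qre (qinner u u) + b * qre (qinner u v)"
    by (simp only: qre_qinner_commute [of u ?w] qre_qinner_left qre_qinner_commute [of v u])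
  moreover have "qre (qinner v ?w) = a * qre (qinner u v) + b * qre (qinner v v)"
    by (simp only: qre_qinner_commute [of v ?w] qre_qinner_left)
  ultimately show ?thesis
    unfolding qre_qinner_left [of a u b v ?w] by (simp add: power2_eq_square algebra_simps)
qed

lemma qnorm_sq: "(qnorm u)\<^sup>2 = qre (qinner u u)"
  by (simp add: qnorm_def qinner_self_ge_0)

lemma qnorm_ge_0: "0 \<le> qnorm u"
  by (simp add: qnorm_def qinner_self_ge_0)

lemma qnorm_eq_0: "qnorm u = 0 \<longleftrightarrow> u = 0"
  using qinner_self_real [of u] qinner_self_eq_0 [of u]
  by (auto simp: Reals_def qnorm_def quat_eq_iff)

lemma qre_qinner_le_qnorm: "qre (qinner u v) \<le> qnorm u * qnorm v"
proof (cases "u = 0 \<or> v = 0")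
  case True
  then have "qre (qinner u v) = 0"
    using qinner_zero_left qre_qinner_commute [of u v] by auto
  then show ?thesis
    by (simp add: qnorm_ge_0)
next
  case False
  then have pos: "0 < qnorm u" "0 < qnorm v"
    using qnorm_ge_0 [of u] qnorm_ge_0 [of v] qnorm_eq_0 [of u] qnorm_eq_0 [of v] by simp_all
  let ?w = "scaleR (qnorm v) u + scaleR (- qnorm u) v"
  have "0 \<le> qre (qinner ?w ?w)"
    by (rule qinner_self_ge_0)
  also have "\<dots> = 2 * (qnorm u * qnorm v) * (qnorm u * qnorm v - qre (qinner u v))"
    unfolding qre_qinner_combination
    unfolding qnorm_sq [symmetric] by (simp add: power2_eq_square algebra_simps)
  finally show ?thesis
    using mult_pos_pos [OF pos] by (auto simp: zero_le_mult_iff)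
qed

lemma qnorm_triangle: "qnorm (u + v) \<le> qnorm u + qnorm v"
proof -
  have "(qnorm (u + v))\<^sup>2 = (qnorm u)\<^sup>2 + 2 * qre (qinner u v) + (qnorm v)\<^sup>2"
    using qre_qinner_combination [of 1 u 1 v] by (simp add: qnorm_sq scaleR_scaleQ scaleQ_one)
  also have "\<dots> \<le> (qnorm u + qnorm v)\<^sup>2"
    using qre_qinner_le_qnorm [of u v] by (simp add: power2_eq_square algebra_simps)
  finally show ?thesis
    by (rule power2_le_imp_le) (simp add: qnorm_ge_0)
qed

lemma qnorm_scaleR: "qnorm (scaleR r u) = \<bar>r\<bar> * qnorm u"
proof -
  have "(qnorm (scaleR r u))\<^sup>2 = (\<bar>r\<bar> * qnorm u)\<^sup>2"
    using qre_qinner_combination [of r u 0 u]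
    by (simp add: qnorm_sq power_mult_distrib scaleR_scaleQ scaleQ_zero_left)
  then show ?thesis
    by (rule power2_eq_imp_eq) (simp_all add: qnorm_ge_0)
qed

end

text \<open>
  Inheriting from \<^class>\<open>real_normed_vector\<close> only makes the norm, metric and topology of the
  library available. It adds no hypothesis on the space: the norm is fixed by the inner product,
  and it satisfies the norm axioms by \<open>qnorm_eq_0\<close>, \<open>qnorm_triangle\<close> and \<open>qnorm_scaleR\<close>.
\<close>

class quat_inner = quat_preinner + real_normed_vector +
  assumes norm_eq_sqrt_qinner: "norm u = sqrt (qre (qinner u u))"

class quat_hilbert = quat_inner + complete_space

instantiation quat :: quat_hilbert
begin

definition "scaleQ (p::quat) (q::quat) = p * q"
definition "qinner (p::quat) q = p * qcnj q"

instance
proof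
  fix p q u v w :: quat and r :: real and X :: "nat \<Rightarrow> quat"
  show "scaleR r = (scaleQ (of_real r) :: quat \<Rightarrow> quat)"
    by (rule ext) (simp add: scaleQ_quat_def scaleR_conv_of_real)
  show "qinner u u \<in> \<real>" "0 \<le> qre (qinner u u)" "qinner u u = 0 \<longleftrightarrow> u = 0"
    "norm u = sqrt (qre (qinner u u))"
    by (simp_all add: qinner_quat_def quat_mult_cnj del: quat_mult_sel of_real_power)
  show "qinner u v = qcnj (qinner v u)"
    by (simp add: qinner_quat_def quat_eq_iff algebra_simps)
  show "convergent X" if "Cauchy X"
  proof -
    let ?f = "\<lambda>q. ((qre q, qi q), (qj q, qk q))"
    let ?g = "\<lambda>((a, b), (c, d)). Quat a b c d"
    have d: "dist (?f p) (?f q) = dist p q" for p q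
      unfolding dist_norm quat_norm_pairs by simp
    have "Cauchy (\<lambda>n. ?f (X n))"
      using that unfolding Cauchy_def d .
    then obtain L where "(\<lambda>n. ?f (X n)) \<longlonglongrightarrow> L"
      using Cauchy_convergent convergent_def by blast
    moreover have "L = ?f (?g L)"
      by (simp split: prod.split)
    ultimately have "(\<lambda>n. ?f (X n)) \<longlonglongrightarrow> ?f (?g L)"
      by simp
    then have "X \<longlonglongrightarrow> ?g L"
      unfolding lim_sequentially d .
    then show ?thesis
      by (rule convergentI)
  qed
qed (simp_all add: scaleQ_quat_def qinner_quat_def algebra_simps)

end


section \<open>Operators\<close>

definition bounded_qlinear :: "('a::quat_hilbert \<Rightarrow> 'a) \<Rightarrow> bool" where
  "bounded_qlinear T \<longleftrightarrow>
    (\<forall>p q u v. T (p *\<^sub>Q u + q *\<^sub>Q v) = p *\<^sub>Q T u + q *\<^sub>Q T v) \<and>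
    (\<exists>c. \<forall>u. norm (T u) \<le> c * norm u)"

text \<open>Meaningful only for bounded left-linear operators, for which existence and uniqueness are
  the Riesz representation theorem.\<close>

definition qadjoint :: "('a::quat_hilbert \<Rightarrow> 'a) \<Rightarrow> 'a \<Rightarrow> 'a" where
  "qadjoint T = (THE S. bounded_qlinear S \<and> (\<forall>u v. qinner (T u) v = qinner u (S v)))"

definition normal_op :: "('a::quat_hilbert \<Rightarrow> 'a) \<Rightarrow> bool" where
  "normal_op T \<longleftrightarrow> T \<circ> qadjoint T = qadjoint T \<circ> T"

definition compact_op :: "('a::quat_hilbert \<Rightarrow> 'a) \<Rightarrow> bool" where
  "compact_op T \<longleftrightarrow> (\<forall>B. bounded B \<longrightarrow> compact (closure (T ` B)))"

definition qeigenvalue :: "('a::quat_hilbert \<Rightarrow> 'a) \<Rightarrow> quat \<Rightarrow> bool" where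
  "qeigenvalue T q \<longleftrightarrow> (\<exists>u. u \<noteq> 0 \<and> T u = q *\<^sub>Q u)"


section \<open>Orthonormal bases\<close>

definition qspan :: "'a::quat_vector set \<Rightarrow> 'a set" where
  "qspan S = {\<Sum>x\<in>F. c x *\<^sub>Q x | F c. finite F \<and> F \<subseteq> S}"

definition qorthonormal :: "'a::quat_hilbert set \<Rightarrow> bool" where
  "qorthonormal S \<longleftrightarrow> (\<forall>x\<in>S. \<forall>y\<in>S. qinner x y = (if x = y then 1 else 0))"

definition qorthonormal_basis :: "'a::quat_hilbert set \<Rightarrow> bool" where
  "qorthonormal_basis S \<longleftrightarrow> qorthonormal S \<and> closure (qspan S) = UNIV"

end

theory Submission
  imports Defs
begin

text \<open>
  The eigenvectors are peeled off one at a time. Suppose \<open>M\<close> is a closed submodule that \<open>T\<close> and its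
  adjoint \<open>T'\<close> map into itself, and let \<open>s\<close> be the operator norm of \<open>T\<close> on \<open>M\<close>. By compactness \<open>s\<close> is
  attained at a unit vector \<open>v\<close> of \<open>M\<close>, and maximality forces \<open>T' (T v) = s\<^sup>2 v\<close> (\<open>norm_attained\<close>).
  Eigenvectors of \<open>T' \<circ> T\<close> need not be eigenvectors of \<open>T\<close>, and \<open>T - l\<close> is not left linear for a
  quaternion \<open>l\<close>, so that the eigenspaces of \<open>T\<close> are in general not submodules. Real eigenvalues cause no such
  trouble, since real numbers are central: the eigenspace \<open>E\<close> of \<open>T' \<circ> T\<close> for \<open>s\<^sup>2\<close> is a submodule,
  invariant under \<open>T\<close> and \<open>T'\<close> by normality. If \<open>s > 0\<close>, bounded sequences in \<open>E\<close> have convergent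
  subsequences, because \<open>u = T' (T u) / s\<^sup>2\<close> there; hence the same extremal argument applies on \<open>E\<close> to the
  self-adjoint operator \<open>T + T'\<close> and yields \<open>w \<noteq> 0\<close> in \<open>E\<close> with \<open>T w + T' w = b w\<close>, where \<open>b\<close> is real.
  Multiplying by \<open>T\<close> gives \<open>T (T w) = b T w - s\<^sup>2 w\<close>, a quadratic equation with real coefficients. A
  quaternion root \<open>c\<close> of \<open>c\<^sup>2 = b c - s\<^sup>2\<close> then makes \<open>T w - c w\<close>, or \<open>w\<close> itself if that vector is zero,
  an eigenvector of \<open>T\<close> (\<open>eigenvector_in_eigenspace\<close>), and its eigenvalue has norm \<open>s\<close>.

  An eigenvector of a normal operator for \<open>l\<close> is an eigenvector of the adjoint for the conjugate of
  \<open>l\<close> (\<open>eigenvector_adjoint\<close>), so the orthogonal complement of eigenvectors already found is again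
  invariant and the construction can be repeated. With \<open>p\<close> the projection of \<open>u\<close> to the span of the
  first \<open>n\<close> eigenvectors, \<open>u - p\<close> lies in that complement, where \<open>T\<close> has norm at most \<open>norm (l n)\<close>.
  These norms tend to \<open>0\<close> because \<open>T\<close> maps the orthonormal \<open>\<xi> n\<close> to orthogonal vectors of norm
  \<open>norm (l n)\<close>, which would otherwise have no convergent subsequence. So \<open>T p \<longlonglongrightarrow> T u\<close>, which is the
  expansion of \<open>T u\<close>; applying \<open>T'\<close> gives that of \<open>K u\<close>. The projections themselves converge by
  Bessel's inequality, to a vector with the same image as \<open>u\<close>, hence to \<open>u\<close> when \<open>T\<close> is injective.

  That the adjoint exists is a consequence of the Riesz representation theorem, proved here by minimising
  \<open>(norm u)\<^sup>2 - 2 * g u\<close>.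
\<close>

section \<open>Geometry of quaternionic inner products\<close>

lemma qcnj_mult: "qcnj (p * q) = qcnj q * qcnj p"
  by (simp add: quat_eq_iff algebra_simps)

lemma qcnj_qcnj [simp]: "qcnj (qcnj q) = q"
  by (simp add: quat_eq_iff)

lemma norm_qcnj [simp]: "norm (qcnj q) = norm q"
  by (simp add: norm_quat_def)

lemma qcnj_mult_self: "qcnj q * q = of_real ((norm q)\<^sup>2)"
  using quat_mult_cnj [of "qcnj q"] by simp

lemma qinner_scaleQ_left: "qinner (p *\<^sub>Q u) w = p * qinner u w"
  using qinner_left [of p u 0 u w] by (simp add: scaleQ_zero_left)

lemma qinner_scaleQ_right: "qinner u (p *\<^sub>Q w) = qinner u w * qcnj p"
  unfolding qinner_commute [of u] by (simp add: qinner_scaleQ_left qcnj_mult)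

lemma qinner_eq_0_commute: "qinner u v = 0 \<longleftrightarrow> qinner v u = 0"
  by (subst qinner_commute) (simp add: quat_eq_iff)

lemma norm_sq_qinner: "(norm (u::'a::quat_inner))\<^sup>2 = qre (qinner u u)"
  by (simp add: norm_eq_sqrt_qinner qinner_self_ge_0)

lemma qinner_self: "qinner u u = of_real ((norm (u::'a::quat_inner))\<^sup>2)"
  using qinner_self_real [of u] unfolding norm_sq_qinner by (auto simp: Reals_def)

lemma quat_of_real_commute: "of_real r * p = p * (of_real r :: quat)"
  by (simp add: quat_eq_iff)

lemma norm_scaleQ: "norm (p *\<^sub>Q u) = norm p * norm (u::'a::quat_inner)"
proof -
  have "qinner (p *\<^sub>Q u) (p *\<^sub>Q u) = p * qcnj p * of_real ((norm u)\<^sup>2)"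
    by (simp only: qinner_scaleQ_left qinner_scaleQ_right qinner_self [of u] mult.assoc
        quat_of_real_commute)
  also have "\<dots> = of_real ((norm p * norm u)\<^sup>2)"
    by (simp only: quat_mult_cnj power_mult_distrib of_real_mult)
  finally have "(norm (p *\<^sub>Q u))\<^sup>2 = (norm p * norm u)\<^sup>2"
    by (simp add: norm_sq_qinner del: of_real_power)
  then show ?thesis
    by (rule power2_eq_imp_eq) simp_all
qed

lemma qre_qinner_le_norm: "qre (qinner u v) \<le> norm u * norm (v::'a::quat_inner)"
  using qre_qinner_le_qnorm [of u v] by (simp add: qnorm_def norm_eq_sqrt_qinner)

text \<open>After multiplication of \<open>u\<close> by the conjugate of \<open>qinner u v\<close> the inner product with \<open>v\<close> is
  real, so that the Cauchy-Schwarz inequality for the real part suffices.\<close>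

lemma norm_qinner_le: "norm (qinner u v) \<le> norm u * norm (v::'a::quat_inner)"
proof (cases "qinner u v = 0")
  case False
  let ?p = "qcnj (qinner u v)"
  have "(norm (qinner u v))\<^sup>2 = qre (qinner (?p *\<^sub>Q u) v)"
    by (simp add: qinner_scaleQ_left qcnj_mult_self del: of_real_power quat_mult_sel)
  also have "\<dots> \<le> norm (qinner u v) * (norm u * norm v)"
    using qre_qinner_le_norm [of "?p *\<^sub>Q u" v] by (simp add: norm_scaleQ mult.assoc)
  finally show ?thesis
    using False by (simp add: power2_eq_square)
qed simp

interpretation scaleQ: bounded_bilinear "scaleQ :: quat \<Rightarrow> 'a \<Rightarrow> 'a::quat_inner"
proof
  fix p q :: quat and u v :: 'a and r :: real
  show "(p + q) *\<^sub>Q u = p *\<^sub>Q u + q *\<^sub>Q u" "p *\<^sub>Q (u + v) = p *\<^sub>Q u + p *\<^sub>Q v"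
    by (rule scaleQ_add_left scaleQ_add_right)+
  show "(r *\<^sub>R p) *\<^sub>Q u = r *\<^sub>R p *\<^sub>Q u" "p *\<^sub>Q r *\<^sub>R u = r *\<^sub>R p *\<^sub>Q u"
    by (simp_all add: scaleR_scaleQ [where 'a = 'a] scaleQ_scaleQ scaleR_conv_of_real
        quat_of_real_commute)
  show "\<exists>K. \<forall>p (u::'a). norm (p *\<^sub>Q u) \<le> norm p * norm u * K"
    by (rule exI [of _ 1]) (simp add: norm_scaleQ)
qed

interpretation qinner: bounded_bilinear "qinner :: 'a \<Rightarrow> 'a::quat_inner \<Rightarrow> quat"
proof
  fix u v w :: 'a and r :: real
  show "qinner (u + v) w = qinner u w + qinner v w"
    by (rule qinner_add_left)
  show "qinner w (u + v) = qinner w u + qinner w v"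
    by (subst (1 2 3) qinner_commute) (simp add: qinner_add_left quat_eq_iff)
  show "qinner (r *\<^sub>R u) v = r *\<^sub>R qinner u v"
    by (simp add: scaleR_scaleQ [where 'a = 'a] qinner_scaleQ_left scaleR_conv_of_real)
  show "qinner u (r *\<^sub>R v) = r *\<^sub>R qinner u v"
    by (simp add: scaleR_scaleQ [where 'a = 'a] qinner_scaleQ_right quat_eq_iff)
  show "\<exists>K. \<forall>u v :: 'a. norm (qinner u v) \<le> norm u * norm v * K"
    by (rule exI [of _ 1]) (simp add: norm_qinner_le)
qed

instance quat_hilbert \<subseteq> banach ..

lemma norm_add_sq:
  "(norm (u + v))\<^sup>2 = (norm u)\<^sup>2 + 2 * qre (qinner u v) + (norm (v::'a::quat_inner))\<^sup>2"
  using qre_qinner_commute [of v u] by (simp add: norm_sq_qinner qinner.add_left qinner.add_right)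

lemma norm_diff_sq:
  "(norm (u - v))\<^sup>2 = (norm u)\<^sup>2 - 2 * qre (qinner u v) + (norm (v::'a::quat_inner))\<^sup>2"
  using qre_qinner_commute [of v u] by (simp add: norm_sq_qinner qinner.diff_left qinner.diff_right)

lemma norm_sum_sq_orthogonal:
  fixes f :: "'i \<Rightarrow> 'a::quat_inner"
  assumes "finite F" and "\<And>i j. i \<in> F \<Longrightarrow> j \<in> F \<Longrightarrow> i \<noteq> j \<Longrightarrow> qinner (f i) (f j) = 0"
  shows "(norm (\<Sum>i\<in>F. f i))\<^sup>2 = (\<Sum>i\<in>F. (norm (f i))\<^sup>2)"
  using assms
proof (induction F)
  case (insert i F)
  have "qinner (f i) (\<Sum>j\<in>F. f j) = 0"
    unfolding qinner.sum_right using insert by (intro sum.neutral) auto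
  then show ?case
    using insert by (simp add: norm_add_sq)
qed simp

lemma qre_bounded_linear: "bounded_linear qre"
proof (rule bounded_linear_intro)
  fix q :: quat
  have "\<bar>qre q\<bar> \<le> norm q"
    by (rule power2_le_imp_le) (simp_all add: quat_norm_sq)
  then show "norm (qre q) \<le> norm q * 1"
    by simp
qed simp_all

text \<open>This transfers identities from the real inner product \<open>qre (qinner u v)\<close> to the quaternionic
  one: multiplication of \<open>u\<close> by the units \<open>1, i, j, k\<close> brings each component into the real part.\<close>

lemma quat_eqI_qre_mult:
  assumes "\<And>r. qre (r * p) = qre (r * q)"
  shows "p = q"
  using assms [of 1] assms [of "Quat 0 1 0 0"] assms [of "Quat 0 0 1 0"] assms [of "Quat 0 0 0 1"]
  by (simp add: quat_eq_iff)

section \<open>The Riesz representation theorem and adjoints\<close>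

text \<open>The representing vector minimises \<open>J u = (norm u)\<^sup>2 - 2 * g u\<close>. This functional is bounded below, and
  by the parallelogram law its minimising sequences are Cauchy. At the minimum \<open>w\<close> the derivative in
  each direction \<open>u\<close>, which is \<open>2 * (qre (qinner u w) - g u)\<close>, vanishes.\<close>

lemma riesz_representation:
  fixes g :: "'a::quat_hilbert \<Rightarrow> real"
  assumes "bounded_linear g"
  obtains w where "\<And>u. g u = qre (qinner u w)"
proof -
  interpret g: bounded_linear g by fact
  define J where "J u = (norm u)\<^sup>2 - 2 * g u" for u
  obtain c where c: "\<And>u. norm (g u) \<le> norm u * c"
    using g.bounded by blast
  have "- c\<^sup>2 \<le> J u" for u
  proof -
    have "0 \<le> (norm u - c)\<^sup>2" by simp
    also have "\<dots> = (norm u)\<^sup>2 - 2 * (norm u * c) + c\<^sup>2"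
      by (simp add: power2_diff)
    finally show ?thesis
      using c [of u] by (simp add: J_def abs_le_iff)
  qed
  then have bdd: "bdd_below (range J)"
    by (auto intro!: bdd_belowI2)
  define m where "m = Inf (range J)"
  have m: "m \<le> J u" for u
    unfolding m_def using bdd by (intro cInf_lower) auto
  have "\<exists>u. J u < m + inverse (real (Suc n))" for n
    using cInf_less_iff [of "range J" "m + inverse (real (Suc n))"] bdd
    by (auto simp: m_def)
  then obtain x where x: "\<And>n. J (x n) < m + inverse (real (Suc n))"
    by metis
  have J_near: "(norm (u - v))\<^sup>2 \<le> 2 * (J u - m) + 2 * (J v - m)" for u v
  proof -
    have "J ((1/2) *\<^sub>R (u + v)) = (norm (u + v))\<^sup>2 / 4 - g u - g v"
      unfolding J_def norm_scaleR by (simp add: g.scaleR g.add power_divide field_simps)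
    then show ?thesis
      using m [of "(1/2) *\<^sub>R (u + v)"]
      by (simp add: J_def norm_add_sq norm_diff_sq field_simps)
  qed
  have "Cauchy x"
  proof (rule metric_CauchyI)
    fix e :: real assume "0 < e"
    then obtain n where n: "inverse (real (Suc n)) < e\<^sup>2 / 4"
      using reals_Archimedean [of "e\<^sup>2 / 4"] by auto
    have near: "J (x i) - m < e\<^sup>2 / 4" if "n \<le> i" for i
    proof -
      have "inverse (real (Suc i)) \<le> inverse (real (Suc n))"
        using that by (intro le_imp_inverse_le) simp_all
      then show ?thesis
        using x [of i] n by linarith
    qed
    have "dist (x i) (x j) < e" if "n \<le> i" "n \<le> j" for i j
    proof (rule power_less_imp_less_base)
      show "(dist (x i) (x j))\<^sup>2 < e\<^sup>2"
        using J_near [of "x i" "x j"] near [OF that(1)] near [OF that(2)]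
        unfolding dist_norm by (simp add: field_simps)
    qed (use \<open>0 < e\<close> in simp)
    then show "\<exists>n. \<forall>i\<ge>n. \<forall>j\<ge>n. dist (x i) (x j) < e"
      by blast
  qed
  then obtain w where w: "x \<longlonglongrightarrow> w"
    using Cauchy_convergent convergent_def by blast
  have "(\<lambda>n. J (x n)) \<longlonglongrightarrow> J w"
    unfolding J_def by (intro tendsto_intros g.tendsto w)
  moreover have "(\<lambda>n. m + inverse (real (Suc n))) \<longlonglongrightarrow> m + 0"
    by (intro tendsto_intros LIMSEQ_inverse_real_of_nat)
  ultimately have "J w \<le> m + 0"
    by (rule LIMSEQ_le) (use x less_imp_le in blast)
  have "g u = qre (qinner u w)" for u
  proof (cases "u = 0")
    case False
    define d where "d = g u - qre (qinner u w)"
    \<comment> \<open>The step that minimises the quadratic \<open>t \<mapsto> J (w + t u)\<close>.\<close>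
    define t where "t = d / (norm u)\<^sup>2"
    have "J (w + t *\<^sub>R u) = J w - 2 * t * d + t\<^sup>2 * (norm u)\<^sup>2"
      using qre_qinner_commute [of w u]
      by (simp add: J_def norm_add_sq g.add g.scaleR qinner.scaleR_right d_def power_mult_distrib
          algebra_simps)
    also have "\<dots> = J w - d\<^sup>2 / (norm u)\<^sup>2"
      using False by (simp add: t_def field_simps power2_eq_square)
    finally have "d\<^sup>2 / (norm u)\<^sup>2 \<le> 0"
      using m [of "w + t *\<^sub>R u"] \<open>J w \<le> m + 0\<close> by simp
    then have "d = 0"
      using False by (simp add: divide_le_0_iff)
    then show ?thesis
      by (simp add: d_def)
  qed (simp add: g.zero qinner.zero_left)
  then show ?thesis ..
qed

lemma bounded_qlinear_imp_bounded_linear: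
  fixes T :: "'a::quat_hilbert \<Rightarrow> 'a"
  assumes "bounded_qlinear T"
  shows "bounded_linear T"
proof -
  have lin: "T (p *\<^sub>Q u + q *\<^sub>Q v) = p *\<^sub>Q T u + q *\<^sub>Q T v" for p q u v
    using assms by (simp add: bounded_qlinear_def)
  obtain c where c: "\<And>u. norm (T u) \<le> c * norm u"
    using assms by (auto simp: bounded_qlinear_def)
  show ?thesis
  proof (rule bounded_linear_intro)
    show "T (u + v) = T u + T v" for u v
      using lin [of 1 u 1 v] by (simp add: scaleQ_one)
    show "T (r *\<^sub>R u) = r *\<^sub>R T u" for r u
      using lin [of "of_real r" u 0 u] by (simp add: scaleR_scaleQ scaleQ_zero_left)
    show "norm (T u) \<le> norm u * c" for u
      using c [of u] by (simp add: mult.commute)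
  qed
qed

lemma bounded_qlinear_scaleQ:
  assumes "bounded_qlinear T"
  shows "T (p *\<^sub>Q u) = p *\<^sub>Q T u"
proof -
  have "T (p *\<^sub>Q u + 0 *\<^sub>Q u) = p *\<^sub>Q T u + 0 *\<^sub>Q T u"
    using assms unfolding bounded_qlinear_def by blast
  then show ?thesis
    by (simp add: scaleQ_zero_left)
qed

lemma qinner_right_eqI:
  assumes "\<And>u. qinner u v = qinner u (w::'a::quat_inner)"
  shows "v = w"
proof -
  have "qinner (v - w) (v - w) = 0"
    using assms [of "v - w"] by (simp add: qinner.diff_right)
  then show ?thesis
    by (simp add: qinner_self_eq_0)
qed

lemma adjoint_exists:
  fixes T :: "'a::quat_hilbert \<Rightarrow> 'a"
  assumes "bounded_qlinear T"
  obtains S where "bounded_qlinear S" and "\<And>u v. qinner (T u) v = qinner u (S v)"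
proof -
  interpret T: bounded_linear T
    using assms by (rule bounded_qlinear_imp_bounded_linear)
  have "\<exists>w. \<forall>u. qinner (T u) v = qinner u w" for v
  proof -
    have "bounded_linear (\<lambda>u. qre (qinner (T u) v))"
      by (intro bounded_linear_compose [OF qre_bounded_linear]
          bounded_linear_compose [OF qinner.bounded_linear_left] T.bounded_linear_axioms)
    then obtain w where w: "\<And>u. qre (qinner (T u) v) = qre (qinner u w)"
      using riesz_representation by blast
    have "qinner (T u) v = qinner u w" for u
    proof (rule quat_eqI_qre_mult)
      \<comment> \<open>Left linearity in \<open>u\<close> absorbs the factor \<open>r\<close>.\<close>
      show "qre (r * qinner (T u) v) = qre (r * qinner u w)" for r
        using w [of "r *\<^sub>Q u"]
        by (simp only: bounded_qlinear_scaleQ [OF assms] qinner_scaleQ_left)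
    qed
    then show ?thesis by blast
  qed
  then obtain S where S: "\<And>u v. qinner (T u) v = qinner u (S v)"
    by metis
  have "S (p *\<^sub>Q u + q *\<^sub>Q v) = p *\<^sub>Q S u + q *\<^sub>Q S v" for p q u v
    by (rule qinner_right_eqI)
      (simp add: qinner.add_right qinner_scaleQ_right flip: S)
  moreover obtain c where c: "\<And>u. norm (T u) \<le> norm u * c" "0 \<le> c"
    using T.nonneg_bounded by blast
  have "norm (S v) \<le> c * norm v" for v
  proof (cases "S v = 0")
    case False
    have "(norm (S v))\<^sup>2 = qre (qinner (T (S v)) v)"
      by (simp add: norm_sq_qinner S)
    also have "\<dots> \<le> norm (T (S v)) * norm v"
      by (rule qre_qinner_le_norm)
    also have "\<dots> \<le> norm (S v) * c * norm v"
      by (intro mult_right_mono c) simp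
    finally show ?thesis
      using False by (simp add: power2_eq_square)
  qed (use c in simp)
  ultimately have "bounded_qlinear S"
    unfolding bounded_qlinear_def by blast
  then show ?thesis
    using S that by blast
qed

lemma qadjoint:
  fixes T :: "'a::quat_hilbert \<Rightarrow> 'a"
  assumes "bounded_qlinear T"
  shows "bounded_qlinear (qadjoint T)" and "qinner (T u) v = qinner u (qadjoint T v)"
proof -
  obtain S where S: "bounded_qlinear S" "\<And>u v. qinner (T u) v = qinner u (S v)"
    using adjoint_exists [OF assms] by blast
  have "qadjoint T = S"
    unfolding qadjoint_def
  proof (rule the_equality)
    fix R assume R: "bounded_qlinear R \<and> (\<forall>u v. qinner (T u) v = qinner u (R v))"
    show "R = S"
    proof (rule ext, rule qinner_right_eqI)
      show "qinner u (R v) = qinner u (S v)" for u v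
        using R S(2) [of u v] by simp
    qed
  qed (use S in blast)
  then show "bounded_qlinear (qadjoint T)" "qinner (T u) v = qinner u (qadjoint T v)"
    by (simp_all only: S)
qed

section \<open>Vectors where a norm is attained\<close>

text \<open>Let \<open>s\<close> be the norm of \<open>B\<close> on \<open>M\<close>. For a unit vector \<open>v\<close> of \<open>M\<close> the defect
  \<open>B' (B v) - s\<^sup>2 v\<close> has squared norm at most \<open>s\<^sup>2 * (s\<^sup>2 - (norm (B v))\<^sup>2)\<close>, so it tends to \<open>0\<close> along a
  maximising sequence. Where \<open>B v\<close> converges, \<open>B' (B v)\<close> does, and therefore so does \<open>v\<close> if \<open>s > 0\<close>.
  Compactness is only asked for on \<open>M\<close>, since the lemma serves also for an operator
  that is not assumed compact on the whole space.\<close>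

lemma norm_attained:
  fixes B B' :: "'a::quat_hilbert \<Rightarrow> 'a" and M :: "'a set"
  assumes B: "bounded_linear B" and B': "bounded_linear B'"
    and adj: "\<And>u v. qinner (B u) v = qinner u (B' v)"
    and M: "subspace M" "closed M" "M \<noteq> {0}"
    and inv: "\<forall>v\<in>M. B' (B v) \<in> M"
    and cpt: "\<forall>f :: nat \<Rightarrow> 'a. (\<forall>n. f n \<in> M \<and> norm (f n) = 1) \<longrightarrow>
      (\<exists>r y. strict_mono r \<and> (\<lambda>n. B (f (r n))) \<longlonglongrightarrow> y)"
  obtains v s where "v \<in> M" "norm v = 1" "0 \<le> s" "B' (B v) = s\<^sup>2 *\<^sub>R v"
    "\<And>w. w \<in> M \<Longrightarrow> norm (B w) \<le> s * norm w"
proof -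
  interpret B: bounded_linear B by fact
  interpret B': bounded_linear B' by fact
  define X where "X = (\<lambda>v. norm (B v)) ` {v \<in> M. norm v = 1}"
  define s where "s = Sup X"
  obtain v0 where v0: "v0 \<in> M" "v0 \<noteq> 0"
    using M subspace_0 by blast
  have unit: "(1 / norm v) *\<^sub>R v \<in> M \<and> norm ((1 / norm v) *\<^sub>R v) = 1" if "v \<in> M" "v \<noteq> 0" for v
    using that M(1) by (simp add: subspace_scale)
  have ne: "X \<noteq> {}"
    using unit [OF v0] unfolding X_def by blast
  obtain c where c: "\<And>u. norm (B u) \<le> norm u * c"
    using B.bounded by blast
  have bdd: "bdd_above X"
    unfolding X_def by (rule bdd_aboveI2 [of _ _ c]) (use c in \<open>metis (mono_tags) mem_Collect_eq mult_1\<close>)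
  have le1: "norm (B v) \<le> s" if "v \<in> M" "norm v = 1" for v
    unfolding s_def using bdd that by (intro cSup_upper) (auto simp: X_def)
  have s0: "0 \<le> s"
    using le1 unit [OF v0] norm_ge_zero order_trans by metis
  have le: "norm (B w) \<le> s * norm w" if "w \<in> M" for w
  proof (cases "w = 0")
    case False
    then show ?thesis
      using le1 [of "(1 / norm w) *\<^sub>R w"] unit [OF that] by (simp add: B.scaleR field_simps)
  qed (simp add: B.zero)
  show ?thesis
  proof (cases "s = 0")
    case True
    then have "B w = 0" if "w \<in> M" for w
      using le [OF that] by simp
    with True show ?thesis
      using that [of "(1 / norm v0) *\<^sub>R v0" 0] unit [OF v0] le by (simp add: B'.zero)
  next
    case False
    then have s: "0 < s" using s0 by simp
    have "\<exists>v. v \<in> M \<and> norm v = 1 \<and> s - inverse (real (Suc n)) < norm (B v)" for n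
      using less_cSup_iff [OF ne bdd, of "s - inverse (real (Suc n))"]
      by (auto simp: s_def X_def)
    then obtain f where f: "\<And>n. f n \<in> M \<and> norm (f n) = 1"
      and fs: "\<And>n. s - inverse (real (Suc n)) < norm (B (f n))"
      by metis
    have "(\<lambda>n. s - inverse (real (Suc n))) \<longlonglongrightarrow> s"
      using tendsto_diff [OF tendsto_const LIMSEQ_inverse_real_of_nat, of s] by simp
    then have lim: "(\<lambda>n. norm (B (f n))) \<longlonglongrightarrow> s"
    proof (rule tendsto_sandwich [rotated 2])
      show "\<forall>\<^sub>F n in sequentially. s - inverse (real (Suc n)) \<le> norm (B (f n))"
        by (intro always_eventually allI less_imp_le fs)
      show "\<forall>\<^sub>F n in sequentially. norm (B (f n)) \<le> s"
        by (intro always_eventually allI le1) (use f in simp_all)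
    qed simp_all
    have defect: "(norm (B' (B v) - s\<^sup>2 *\<^sub>R v))\<^sup>2 \<le> s\<^sup>2 * (s\<^sup>2 - (norm (B v))\<^sup>2)"
      if v: "v \<in> M" "norm v = 1" for v
    proof -
      \<comment> \<open>\<open>B'\<close> is bounded by \<open>s\<close> as well on vectors \<open>B v\<close>, because \<open>B' (B v)\<close> is again in \<open>M\<close>.\<close>
      have "(norm (B' (B v)))\<^sup>2 = qre (qinner (B (B' (B v))) (B v))"
        by (simp add: norm_sq_qinner adj)
      also have "\<dots> \<le> norm (B (B' (B v))) * norm (B v)"
        by (rule qre_qinner_le_norm)
      also have "\<dots> \<le> (s * norm (B' (B v))) * norm (B v)"
        by (intro mult_right_mono le bspec [OF inv] v) simp
      finally have "norm (B' (B v)) \<le> s * norm (B v)"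
        by (cases "B' (B v) = 0") (simp_all add: power2_eq_square s0)
      then have "(norm (B' (B v)))\<^sup>2 \<le> (s * norm (B v))\<^sup>2"
        by (rule power_mono) simp
      moreover have "qre (qinner (B' (B v)) v) = (norm (B v))\<^sup>2"
        by (simp add: norm_sq_qinner adj qre_qinner_commute [of _ v])
      ultimately show ?thesis
        using v by (simp add: norm_diff_sq qinner.scaleR_right power_mult_distrib algebra_simps)
    qed
    obtain r y where r: "strict_mono r" and y: "(\<lambda>n. B (f (r n))) \<longlonglongrightarrow> y"
      using cpt [THEN spec, of f] f by auto
    have "(\<lambda>n. s\<^sup>2 * (s\<^sup>2 - (norm (B (f (r n))))\<^sup>2)) \<longlonglongrightarrow> s\<^sup>2 * (s\<^sup>2 - s\<^sup>2)"
      using LIMSEQ_subseq_LIMSEQ [OF lim r] by (intro tendsto_intros) (simp add: o_def)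
    then have "(\<lambda>n. s\<^sup>2 * (s\<^sup>2 - (norm (B (f (r n))))\<^sup>2)) \<longlonglongrightarrow> 0"
      by simp
    then have "(\<lambda>n. (norm (B' (B (f (r n))) - s\<^sup>2 *\<^sub>R f (r n)))\<^sup>2) \<longlonglongrightarrow> 0"
      by (rule Lim_null_comparison [rotated]) (simp add: f defect)
    then have "(\<lambda>n. B' (B (f (r n))) - s\<^sup>2 *\<^sub>R f (r n)) \<longlonglongrightarrow> 0"
      by (simp add: tendsto_norm_zero_iff)
    then have "(\<lambda>n. (1 / s\<^sup>2) *\<^sub>R (B' (B (f (r n))) - (B' (B (f (r n))) - s\<^sup>2 *\<^sub>R f (r n))))
        \<longlonglongrightarrow> (1 / s\<^sup>2) *\<^sub>R (B' y - 0)"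
      by (intro tendsto_intros B'.tendsto y)
    then obtain v where v: "(\<lambda>n. f (r n)) \<longlonglongrightarrow> v"
      using s by auto
    have "v \<in> M"
      using closed_sequentially [OF \<open>closed M\<close> _ v] f by blast
    moreover have "norm v = 1"
      using tendsto_norm [OF v] f by (simp add: LIMSEQ_const_iff)
    moreover have "norm (B v) = s"
      using LIMSEQ_unique [OF tendsto_norm [OF B.tendsto [OF v]]] LIMSEQ_subseq_LIMSEQ [OF lim r]
      by (simp add: o_def)
    ultimately have "B' (B v) = s\<^sup>2 *\<^sub>R v"
      using defect [of v] by simp
    then show ?thesis
      using that \<open>v \<in> M\<close> \<open>norm v = 1\<close> s0 le by blast
  qed
qed

section \<open>Eigenvectors of compact normal operators\<close>

text \<open>The root can be found in the subfield of complex numbers \<open>x + y i\<close>.\<close>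

lemma quat_quadratic_root:
  obtains c :: quat where "c * c = of_real b * c - of_real a"
proof (cases "b\<^sup>2 / 4 \<le> a")
  case True
  define y where "y = sqrt (a - b\<^sup>2 / 4)"
  have "y * y = a - b\<^sup>2 / 4"
    using True by (simp add: y_def)
  then have "Quat (b/2) y 0 0 * Quat (b/2) y 0 0 = of_real b * Quat (b/2) y 0 0 - of_real a"
    by (simp add: quat_eq_iff power2_eq_square)
  then show ?thesis ..
next
  case False
  define y where "y = b/2 + sqrt (b\<^sup>2 / 4 - a)"
  have "y * y = b * y - a"
    using False by (simp add: y_def algebra_simps power2_eq_square flip: power2_eq_square [of "sqrt _"])
  then have "of_real y * of_real y = of_real b * of_real y - (of_real a :: quat)"
    by (metis of_real_diff of_real_mult)
  then show ?thesis ..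
qed

definition qorth :: "'a::quat_inner set \<Rightarrow> 'a set" where
  "qorth S = {u. \<forall>x\<in>S. qinner u x = 0}"

lemma qorth_qsubmodule: "u \<in> qorth S \<Longrightarrow> v \<in> qorth S \<Longrightarrow> p *\<^sub>Q u + q *\<^sub>Q v \<in> qorth S"
  by (simp add: qorth_def qinner_left)

lemma closed_qorth: "closed (qorth S)"
proof -
  have "qorth S = (\<Inter>x\<in>S. {u. qinner u x = 0})"
    by (auto simp: qorth_def)
  moreover have "closed {u. qinner u x = 0}" for x :: 'a
    by (intro closed_Collect_eq continuous_intros linear_continuous_on qinner.bounded_linear_left)
  ultimately show ?thesis
    by auto
qed

lemma qsubmodule_imp_subspace:
  fixes M :: "'a::quat_inner set"
  assumes "0 \<in> M" and M: "\<And>p q u v. u \<in> M \<Longrightarrow> v \<in> M \<Longrightarrow> p *\<^sub>Q u + q *\<^sub>Q v \<in> M"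
  shows "subspace M"
proof (rule subspaceI)
  show "u + v \<in> M" if "u \<in> M" "v \<in> M" for u v
    using M [OF that, of 1 1] by (simp add: scaleQ_one)
  show "r *\<^sub>R u \<in> M" if "u \<in> M" for r u
    using M [OF that that, of "of_real r" 0] by (simp add: scaleR_scaleQ scaleQ_zero_left)
qed fact

locale compact_normal =
  fixes T T' :: "'a::quat_hilbert \<Rightarrow> 'a"
  assumes qlin: "bounded_qlinear T" and qlin': "bounded_qlinear T'"
    and adj: "qinner (T u) v = qinner u (T' v)"
    and normal: "T (T' u) = T' (T u)"
    and cpt: "compact_op T"
begin

sublocale T: bounded_linear T
  using qlin by (rule bounded_qlinear_imp_bounded_linear)

sublocale T': bounded_linear T'
  using qlin' by (rule bounded_qlinear_imp_bounded_linear)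

lemmas T_scaleQ = bounded_qlinear_scaleQ [OF qlin] bounded_qlinear_scaleQ [OF qlin']

lemma adj': "qinner (T' u) v = qinner u (T v)"
  unfolding qinner_commute [of "T' u"] qinner_commute [of u] adj ..

lemma convergent_subseq:
  assumes "\<And>n. norm (f n) \<le> 1"
  shows "\<exists>r y. strict_mono (r :: nat \<Rightarrow> nat) \<and> (\<lambda>n. T (f (r n))) \<longlonglongrightarrow> y"
proof -
  have "compact (closure (T ` cball 0 1))"
    using cpt by (simp add: compact_op_def)
  moreover have "T (f n) \<in> closure (T ` cball 0 1)" for n
    using assms by (intro subsetD [OF closure_subset]) auto
  ultimately obtain y r where "strict_mono r" "((\<lambda>n. T (f n)) \<circ> r) \<longlonglongrightarrow> y"
    unfolding compact_def by metis
  then show ?thesis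
    by (auto simp: o_def)
qed

lemma norm_adjoint: "norm (T' x) = norm (T x)"
proof (rule power2_eq_imp_eq)
  have "(norm (T' x))\<^sup>2 = qre (qinner x (T (T' x)))"
    by (simp only: norm_sq_qinner adj')
  also have "\<dots> = (norm (T x))\<^sup>2"
    by (simp only: norm_sq_qinner adj normal)
  finally show "(norm (T' x))\<^sup>2 = (norm (T x))\<^sup>2" .
qed simp_all

text \<open>The vectors \<open>T' x\<close> and \<open>qcnj l *\<^sub>Q x\<close> have equal norms, by normality, and the real part of
  their inner product is the product of these norms; so their distance is \<open>0\<close>. Subtracting \<open>l\<close> from \<open>T\<close>
  as over the complex numbers is not an option, the difference not being left linear.\<close>

lemma eigenvector_adjoint:
  assumes "T x = l *\<^sub>Q x"
  shows "T' x = qcnj l *\<^sub>Q x"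
proof -
  have "T (qcnj l *\<^sub>Q x) = (norm l)\<^sup>2 *\<^sub>R x"
    by (simp only: T_scaleQ assms scaleQ_scaleQ qcnj_mult_self scaleR_scaleQ)
  then have "qre (qinner (T' x) (qcnj l *\<^sub>Q x)) = (norm l * norm x)\<^sup>2"
    by (simp add: adj' qinner.scaleR_right norm_sq_qinner power_mult_distrib)
  then have "(norm (T' x - qcnj l *\<^sub>Q x))\<^sup>2 = 0"
    unfolding norm_diff_sq norm_adjoint assms by (simp add: norm_scaleQ)
  then show ?thesis
    by simp
qed

text \<open>By normality \<open>T (T w) = b T w - a w\<close>, so that the span of \<open>w\<close> and \<open>T w\<close> is invariant. If
  \<open>c\<^sup>2 = b c - a\<close>, then \<open>T (T w - c w) = (b - c) (T w - c w)\<close>, where the real numbers \<open>a\<close> and \<open>b\<close> commute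
  with \<open>c\<close>. The description of \<open>x\<close> shows that it lies in every submodule that contains \<open>w\<close> and \<open>T w\<close>.\<close>

lemma eigenvector_in_eigenspace:
  assumes w: "w \<noteq> 0" and sum: "T w + T' w = b *\<^sub>R w" and K: "T' (T w) = a *\<^sub>R w"
  obtains x l c where "x \<noteq> 0" "T x = l *\<^sub>Q x" "x = w \<or> x = T w - c *\<^sub>Q w"
proof -
  obtain c :: quat where c: "c * c = of_real b * c - of_real a"
    using quat_quadratic_root .
  define z where "z = T w - c *\<^sub>Q w"
  have T': "T' w = b *\<^sub>R w - T w"
    using sum by (simp add: algebra_simps)
  have TT: "T (T w) = of_real b *\<^sub>Q T w - of_real a *\<^sub>Q w"
    using normal [of w] unfolding K T'
    by (simp add: T.diff T.scaleR algebra_simps flip: scaleR_scaleQ)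
  have "of_real b * c = of_real a + c * c"
    using c by (simp add: algebra_simps)
  then have "T z = (of_real b - c) *\<^sub>Q z"
    by (simp add: z_def T.diff T_scaleQ TT scaleQ.diff_left scaleQ.diff_right scaleQ_scaleQ
        scaleQ.add_left left_diff_distrib)
  then show ?thesis
  proof (cases "z = 0")
    case True
    then have "T w = c *\<^sub>Q w"
      by (simp add: z_def)
    then show ?thesis
      using that w by blast
  next
    case False
    then show ?thesis
      using that \<open>T z = _\<close> z_def by blast
  qed
qed

text \<open>The extremal argument is used twice: for \<open>T\<close> on \<open>M\<close>, and then for the self-adjoint \<open>T + T'\<close> on the
  eigenspace of \<open>T' \<circ> T\<close> found in this way. Every eigenvector of \<open>T\<close> in that eigenspace has an eigenvalue of
  the maximal norm \<open>s\<close>.\<close>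

lemma maximal_eigenvector:
  assumes M: "closed M" "\<And>p q u v. u \<in> M \<Longrightarrow> v \<in> M \<Longrightarrow> p *\<^sub>Q u + q *\<^sub>Q v \<in> M"
    and inv: "\<And>u. u \<in> M \<Longrightarrow> T u \<in> M" "\<And>u. u \<in> M \<Longrightarrow> T' u \<in> M"
    and u0: "u0 \<in> M" "T u0 \<noteq> 0"
  obtains x l where "x \<in> M" "norm x = 1" "l \<noteq> 0" "T x = l *\<^sub>Q x"
    "\<And>u. u \<in> M \<Longrightarrow> norm (T u) \<le> norm l * norm u"
proof -
  have "0 \<in> M"
    using M(2) [OF u0(1) u0(1), of 0 0] by (simp add: scaleQ_zero_left)
  then have sub_M: "subspace M"
    using M(2) by (rule qsubmodule_imp_subspace)
  have ne_M: "M \<noteq> {0}"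
    using u0 T.zero by auto
  have inv_M: "\<forall>u\<in>M. T' (T u) \<in> M"
    using inv by blast
  have cpt_M: "\<forall>f :: nat \<Rightarrow> 'a. (\<forall>n. f n \<in> M \<and> norm (f n) = 1) \<longrightarrow>
      (\<exists>r y. strict_mono r \<and> (\<lambda>n. T (f (r n))) \<longlonglongrightarrow> y)"
    by (intro allI impI convergent_subseq) simp
  obtain v s where v: "v \<in> M" "norm v = 1"
    and s: "0 \<le> s" "T' (T v) = s\<^sup>2 *\<^sub>R v" "\<And>w. w \<in> M \<Longrightarrow> norm (T w) \<le> s * norm w"
    by (rule norm_attained [OF T.bounded_linear_axioms T'.bounded_linear_axioms adj sub_M M(1) ne_M
          inv_M cpt_M])
      (rule that)
  have "s \<noteq> 0"
    using s(3) [OF u0(1)] u0(2) by auto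
  define E where "E = {u \<in> M. T' (T u) = s\<^sup>2 *\<^sub>R u}"
  have E_sub: "p *\<^sub>Q u + q *\<^sub>Q w \<in> E" if "u \<in> E" "w \<in> E" for p q u w
    using that M(2) by (simp add: E_def T.add T'.add T_scaleQ scaleQ.scaleR_right scaleR_add_right)
  have "0 \<in> E"
    using \<open>0 \<in> M\<close> by (simp add: E_def T.zero T'.zero)
  then have E: "subspace E"
    using E_sub by (rule qsubmodule_imp_subspace)
  have E_inv: "T u \<in> E" "T' u \<in> E" if "u \<in> E" for u
    using that inv normal [of u] normal [of "T u"] normal [of "T' u"]
    by (auto simp: E_def T.scaleR T'.scaleR)
  let ?A = "\<lambda>u. T u + T' u"
  have A: "bounded_linear ?A"
    by (intro bounded_linear_add T.bounded_linear_axioms T'.bounded_linear_axioms)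
  have A_E: "?A u \<in> E" if "u \<in> E" for u
    using that E E_inv by (intro subspace_add)
  have closed_E: "closed E"
  proof -
    have "closed {u. T' (T u) = s\<^sup>2 *\<^sub>R u}"
      by (intro closed_Collect_eq linear_continuous_on bounded_linear_scaleR_right
          bounded_linear_compose [OF T'.bounded_linear_axioms T.bounded_linear_axioms])
    moreover have "E = M \<inter> {u. T' (T u) = s\<^sup>2 *\<^sub>R u}"
      by (auto simp: E_def)
    ultimately show ?thesis
      using M(1) by (simp add: closed_Int)
  qed
  have ne_E: "E \<noteq> {0}"
  proof -
    have "v \<in> E"
      using v(1) s(2) by (simp add: E_def)
    moreover have "v \<noteq> 0"
      using v(2) by auto
    ultimately show ?thesis by blast
  qed
  have adj_A: "qinner (?A u) w = qinner u (?A w)" for u w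
    by (simp add: adj adj' qinner.add_left qinner.add_right)
  have inv_A: "\<forall>u\<in>E. ?A (?A u) \<in> E"
    using A_E by blast
  have cpt_E: "\<forall>f :: nat \<Rightarrow> 'a. (\<forall>n. f n \<in> E \<and> norm (f n) = 1) \<longrightarrow>
      (\<exists>r y. strict_mono r \<and> (\<lambda>n. ?A (f (r n))) \<longlonglongrightarrow> y)"
  proof (intro allI impI)
    fix f :: "nat \<Rightarrow> 'a" assume f: "\<forall>n. f n \<in> E \<and> norm (f n) = 1"
    then obtain r y where r: "strict_mono r" and y: "(\<lambda>n. T (f (r n))) \<longlonglongrightarrow> y"
      using convergent_subseq [of f] by auto
    \<comment> \<open>On \<open>E\<close> the vectors themselves converge, being \<open>T' (T (f (r n)))\<close> up to the factor \<open>s\<^sup>2\<close>.\<close>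
    have "(\<lambda>n. (1 / s\<^sup>2) *\<^sub>R T' (T (f (r n)))) \<longlonglongrightarrow> (1 / s\<^sup>2) *\<^sub>R T' y"
      by (intro tendsto_intros T'.tendsto y)
    moreover have "(1 / s\<^sup>2) *\<^sub>R T' (T (f (r n))) = f (r n)" for n
      using f \<open>s \<noteq> 0\<close> by (simp add: E_def)
    ultimately have "(\<lambda>n. ?A (f (r n))) \<longlonglongrightarrow> ?A ((1 / s\<^sup>2) *\<^sub>R T' y)"
      by (intro tendsto_add T.tendsto T'.tendsto) simp_all
    then show "\<exists>r y. strict_mono r \<and> (\<lambda>n. ?A (f (r n))) \<longlonglongrightarrow> y"
      using r by blast
  qed
  obtain w0 a where w0: "w0 \<in> E" "norm w0 = 1" "?A (?A w0) = a\<^sup>2 *\<^sub>R w0"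
    by (rule norm_attained [OF A A adj_A E closed_E ne_E inv_A cpt_E])
      (rule that)
  \<comment> \<open>With \<open>A = T + T'\<close>, the identity \<open>A (A w0) = a\<^sup>2 w0\<close> reads \<open>(A - a) ((A + a) w0) = 0\<close>.\<close>
  obtain w b where w: "w \<in> E" "w \<noteq> 0" "?A w = b *\<^sub>R w"
  proof (cases "?A w0 + a *\<^sub>R w0 = 0")
    case True
    then have "?A w0 = (- a) *\<^sub>R w0"
      by (simp add: eq_neg_iff_add_eq_0)
    then show ?thesis
      using that [of w0 "-a"] w0(1,2) by fastforce
  next
    case False
    have "?A (?A w0 + a *\<^sub>R w0) = ?A (?A w0) + a *\<^sub>R ?A w0"
      by (simp add: T.add T'.add T.scaleR T'.scaleR scaleR_add_right)
    also have "\<dots> = a *\<^sub>R (?A w0 + a *\<^sub>R w0)"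
      unfolding w0(3) by (simp add: scaleR_add_right power2_eq_square)
    finally have "?A (?A w0 + a *\<^sub>R w0) = a *\<^sub>R (?A w0 + a *\<^sub>R w0)" .
    moreover have "?A w0 + a *\<^sub>R w0 \<in> E"
      by (rule subspace_add [OF E A_E [OF w0(1)] subspace_scale [OF E w0(1)]])
    ultimately show ?thesis
      using that False by blast
  qed
  have "T' (T w) = s\<^sup>2 *\<^sub>R w"
    using w(1) by (simp add: E_def)
  then obtain x l c where x: "x \<noteq> 0" "T x = l *\<^sub>Q x" "x = w \<or> x = T w - c *\<^sub>Q w"
    using eigenvector_in_eigenspace [OF w(2,3)] by metis
  have "T w - c *\<^sub>Q w \<in> E"
    using E_sub [OF E_inv(1) [OF w(1)] w(1), of 1 "- c"] by (simp add: scaleQ_one scaleQ.minus_left)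
  then have "x \<in> E"
    using x(3) w(1) by auto
  then have "(norm (T x))\<^sup>2 = (s * norm x)\<^sup>2"
    by (simp add: norm_sq_qinner [of "T x"] adj E_def qinner.scaleR_right power_mult_distrib
        norm_sq_qinner [of x])
  then have "norm (T x) = s * norm x"
    by (rule power2_eq_imp_eq) (simp_all add: s(1))
  then have l: "norm l = s"
    using x by (simp add: norm_scaleQ)
  show ?thesis
  proof (rule that)
    show "(1 / norm x) *\<^sub>R x \<in> M"
      using \<open>x \<in> E\<close> sub_M by (simp add: E_def subspace_scale)
    show "norm ((1 / norm x) *\<^sub>R x) = 1"
      using x(1) by simp
    show "l \<noteq> 0"
      using l \<open>s \<noteq> 0\<close> by auto
    show "T ((1 / norm x) *\<^sub>R x) = l *\<^sub>Q (1 / norm x) *\<^sub>R x"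
      by (simp add: T.scaleR x(2) scaleQ.scaleR_right)
    show "norm (T u) \<le> norm l * norm u" if "u \<in> M" for u
      using s(3) [OF that] l by simp
  qed
qed

end

section \<open>The sequence of eigenvectors\<close>

text \<open>Once \<open>T\<close> vanishes on the orthogonal complement of the eigenvectors chosen so far, the sequence is
  continued by zeros. Its nonzero part is the sequence of the theorem, finite or not, while sums
  and limits can be taken over all natural numbers in both cases.\<close>

locale eigensequence = compact_normal T T'
  for T T' :: "'a::quat_hilbert \<Rightarrow> 'a" +
  fixes \<xi> :: "nat \<Rightarrow> 'a" and l :: "nat \<Rightarrow> quat"
  assumes \<xi>_orth: "\<xi> n \<in> qorth (\<xi> ` {..<n})"
    and T_\<xi>: "T (\<xi> n) = l n *\<^sub>Q \<xi> n"
    and T_bound: "u \<in> qorth (\<xi> ` {..<n}) \<Longrightarrow> norm (T u) \<le> norm (l n) * norm u"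
    and unit_or_zero: "norm (\<xi> n) = 1 \<and> l n \<noteq> 0 \<or> \<xi> n = 0 \<and> l n = 0"

lemma (in compact_normal) eigensequence_exists:
  "\<exists>\<xi> l. eigensequence T T' \<xi> l"
proof -
  define P where "P f n = (\<lambda>(x, l). x \<in> qorth ((fst \<circ> f) ` {..<n}) \<and> T x = l *\<^sub>Q x \<and>
      (\<forall>u \<in> qorth ((fst \<circ> f) ` {..<n}). norm (T u) \<le> norm l * norm u) \<and>
      (norm x = 1 \<and> l \<noteq> 0 \<or> x = 0 \<and> l = 0))" for f :: "nat \<Rightarrow> 'a \<times> quat" and n
  have "\<exists>f. \<forall>n. P f n (f n)"
  proof (rule dependent_wellorder_choice)
    fix r and f g :: "nat \<Rightarrow> 'a \<times> quat" and n :: nat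
    assume "\<And>m. m < n \<Longrightarrow> f m = g m"
    then have "(fst \<circ> f) ` {..<n} = (fst \<circ> g) ` {..<n}"
      by (intro image_cong) auto
    then show "P f n r = P g n r"
      by (simp add: P_def)
  next
    fix n :: nat and f :: "nat \<Rightarrow> 'a \<times> quat" assume *: "\<And>m. m < n \<Longrightarrow> P f m (f m)"
    let ?S = "(fst \<circ> f) ` {..<n}"
    have T_S: "T x = l *\<^sub>Q x \<and> T' x = qcnj l *\<^sub>Q x" if "x = fst (f m)" "l = snd (f m)" "m < n" for m x l
      using *[of m] that eigenvector_adjoint by (auto simp: P_def split: prod.splits)
    have inv: "T u \<in> qorth ?S" "T' u \<in> qorth ?S" if "u \<in> qorth ?S" for u
      using that T_S by (auto simp: qorth_def adj adj' qinner_scaleQ_right)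
    \<comment> \<open>The complement is invariant since \<open>T\<close> and \<open>T'\<close> map each earlier vector to a multiple of itself.\<close>
    show "\<exists>r. P f n r"
    proof (cases "\<forall>u \<in> qorth ?S. T u = 0")
      case True
      then have "P f n (0, 0)"
        by (simp add: P_def T.zero qorth_def qinner.zero_left scaleQ_zero_left)
      then show ?thesis ..
    next
      case False
      then obtain u0 where "u0 \<in> qorth ?S" "T u0 \<noteq> 0"
        by blast
      then obtain x l where "x \<in> qorth ?S" "norm x = 1" "l \<noteq> 0" "T x = l *\<^sub>Q x"
          "\<And>u. u \<in> qorth ?S \<Longrightarrow> norm (T u) \<le> norm l * norm u"
        using maximal_eigenvector [OF closed_qorth qorth_qsubmodule inv] by blast
      then have "P f n (x, l)"
        by (simp add: P_def)
      then show ?thesis ..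
    qed
  qed
  then obtain f where f: "\<And>n. P f n (f n)"
    by blast
  have "eigensequence T T' (fst \<circ> f) (snd \<circ> f)"
    by unfold_locales (use f in \<open>auto simp: P_def case_prod_beta\<close>)
  then show ?thesis by blast
qed

context eigensequence
begin

lemma \<xi>_orthogonal: "i \<noteq> j \<Longrightarrow> qinner (\<xi> i) (\<xi> j) = 0"
  using \<xi>_orth [of i] \<xi>_orth [of j] qinner_eq_0_commute [of "\<xi> i" "\<xi> j"]
  by (cases i j rule: linorder_cases) (auto simp: qorth_def)

lemma T'_\<xi>: "T' (\<xi> n) = qcnj (l n) *\<^sub>Q \<xi> n"
  using T_\<xi> by (rule eigenvector_adjoint)

lemma K_\<xi>: "T (T' (\<xi> n)) = of_real ((norm (l n))\<^sup>2) *\<^sub>Q \<xi> n"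
  by (simp only: T'_\<xi> T_scaleQ T_\<xi> scaleQ_scaleQ qcnj_mult_self)

lemma norm_l_decseq: "decseq (\<lambda>n. norm (l n))"
proof (rule decseq_SucI)
  fix n
  have "\<xi> (Suc n) \<in> qorth (\<xi> ` {..<n})"
    using \<xi>_orth [of "Suc n"] by (auto simp: qorth_def)
  then have "norm (l (Suc n)) * norm (\<xi> (Suc n)) \<le> norm (l n) * norm (\<xi> (Suc n))"
    using T_bound [of "\<xi> (Suc n)" n] by (simp add: T_\<xi> norm_scaleQ)
  then show "norm (l (Suc n)) \<le> norm (l n)"
    using unit_or_zero [of "Suc n"] by auto
qed

text \<open>Distinct vectors \<open>T (\<xi> i)\<close>, \<open>T (\<xi> j)\<close> are orthogonal, so the square of their distance is
  \<open>(norm (l i))\<^sup>2 + (norm (l j))\<^sup>2\<close>. Along a convergent subsequence it tends to \<open>0\<close>, but also to \<open>2 L\<^sup>2\<close>,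
  where \<open>L\<close> is the limit of the decreasing norms.\<close>

lemma norm_l_tendsto_0: "(\<lambda>n. norm (l n)) \<longlonglongrightarrow> 0"
proof -
  obtain L where L: "(\<lambda>n. norm (l n)) \<longlonglongrightarrow> L" "\<And>n. L \<le> norm (l n)"
    using decseq_convergent [OF norm_l_decseq, of 0] by auto
  have "norm (\<xi> n) \<le> 1" for n
    using unit_or_zero [of n] by auto
  then obtain r y where r: "strict_mono r" and y: "(\<lambda>n. T (\<xi> (r n))) \<longlonglongrightarrow> y"
    using convergent_subseq by blast
  have "(norm (T (\<xi> (r (Suc n))) - T (\<xi> (r n))))\<^sup>2 = (norm (l (r (Suc n))))\<^sup>2 + (norm (l (r n)))\<^sup>2" for n
  proof -
    have "r (Suc n) \<noteq> r n"
      using r strict_mono_eq by fastforce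
    moreover have "norm (l i *\<^sub>Q \<xi> i) = norm (l i)" for i
      using unit_or_zero [of i] by (auto simp: norm_scaleQ)
    ultimately show ?thesis
      using \<xi>_orthogonal by (simp add: T_\<xi> norm_diff_sq qinner_scaleQ_left qinner_scaleQ_right)
  qed
  moreover have "(\<lambda>n. (norm (T (\<xi> (r (Suc n))) - T (\<xi> (r n))))\<^sup>2) \<longlonglongrightarrow> (norm (y - y))\<^sup>2"
    by (intro tendsto_intros LIMSEQ_Suc [OF y] y)
  moreover have "(\<lambda>n. norm (l (r n))) \<longlonglongrightarrow> L"
    using LIMSEQ_subseq_LIMSEQ [OF L(1) r] by (simp add: o_def)
  then have "(\<lambda>n. (norm (l (r (Suc n))))\<^sup>2 + (norm (l (r n)))\<^sup>2) \<longlonglongrightarrow> L\<^sup>2 + L\<^sup>2"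
    by (intro tendsto_intros LIMSEQ_Suc [of "\<lambda>n. norm (l (r n))"])
  ultimately have "L\<^sup>2 + L\<^sup>2 = 0"
    using LIMSEQ_unique by fastforce
  then show ?thesis
    using L(1) by simp
qed

lemma \<xi>_eq_0_iff: "\<xi> n = 0 \<longleftrightarrow> l n = 0"
  using unit_or_zero [of n] by auto

lemma \<xi>_eq_0_mono: "m \<le> n \<Longrightarrow> \<xi> m = 0 \<Longrightarrow> \<xi> n = 0"
  using decseqD [OF norm_l_decseq, of m n] by (simp add: \<xi>_eq_0_iff)

definition proj :: "nat \<Rightarrow> 'a \<Rightarrow> 'a" where
  "proj n u = (\<Sum>k<n. qinner u (\<xi> k) *\<^sub>Q \<xi> k)"

lemma proj_residual: "u - proj n u \<in> qorth (\<xi> ` {..<n})"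
proof -
  have "qinner (proj n u) (\<xi> j) = qinner u (\<xi> j)" if "j < n" for j
  proof -
    have "qinner (proj n u) (\<xi> j) = (\<Sum>k<n. if k = j then qinner u (\<xi> j) * qinner (\<xi> j) (\<xi> j) else 0)"
      unfolding proj_def qinner.sum_left qinner_scaleQ_left
      by (intro sum.cong) (auto simp: \<xi>_orthogonal)
    also have "\<dots> = qinner u (\<xi> j)"
      using that unit_or_zero [of j] by (auto simp: qinner_self qinner.zero_right)
    finally show ?thesis .
  qed
  then show ?thesis
    by (auto simp: qorth_def qinner.diff_left)
qed

lemma norm_proj_sq: "(norm u)\<^sup>2 = (norm (u - proj n u))\<^sup>2 + (norm (proj n u))\<^sup>2"
proof -
  have "qinner (u - proj n u) (proj n u) = 0"
    unfolding proj_def [of n u] qinner.sum_right qinner_scaleQ_right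
    using proj_residual [of u n] by (intro sum.neutral) (auto simp: qorth_def proj_def)
  then show ?thesis
    using norm_add_sq [of "u - proj n u" "proj n u"] by simp
qed

lemma T_proj_tendsto: "(\<lambda>n. T (proj n u)) \<longlonglongrightarrow> T u"
proof -
  have bound: "norm (T (u - proj n u)) \<le> norm (l n) * norm u" for n
  proof -
    have "norm (u - proj n u) \<le> norm u"
      by (rule power2_le_imp_le) (simp_all add: norm_proj_sq [of u n])
    then show ?thesis
      using T_bound [OF proj_residual, of u n] by (meson mult_left_mono norm_ge_zero order_trans)
  qed
  have "(\<lambda>n. norm (l n) * norm u) \<longlonglongrightarrow> 0"
    by (intro tendsto_mult_left_zero norm_l_tendsto_0)
  then have "(\<lambda>n. T (u - proj n u)) \<longlonglongrightarrow> 0"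
    by (rule Lim_null_comparison [rotated, where g = "\<lambda>n. norm (l n) * norm u"]) (simp add: bound)
  from tendsto_diff [OF tendsto_const this, of "T u"] show ?thesis
    by (simp add: T.diff)
qed

lemma T_expansion: "(\<lambda>k. qinner u (\<xi> k) *\<^sub>Q l k *\<^sub>Q \<xi> k) sums T u"
  using T_proj_tendsto by (simp add: sums_def proj_def T.sum T_scaleQ T_\<xi>)

lemma K_expansion:
  "(\<lambda>k. qinner u (\<xi> k) *\<^sub>Q of_real ((norm (l k))\<^sup>2) *\<^sub>Q \<xi> k) sums T (T' u)"
  using T'.tendsto [OF T_proj_tendsto [of u]]
  by (simp only: sums_def proj_def T.sum T'.sum T_scaleQ normal [symmetric] K_\<xi>)

text \<open>Bessel's inequality bounds the sums of the squared norms of the terms, which by Pythagoras control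
  the tails of the series.\<close>

lemma proj_convergent: "convergent (\<lambda>n. proj n u)"
proof -
  let ?f = "\<lambda>k. qinner u (\<xi> k) *\<^sub>Q \<xi> k"
  have pyth: "(norm (sum ?f F))\<^sup>2 = (\<Sum>k\<in>F. (norm (?f k))\<^sup>2)" if "finite F" for F
    using that by (rule norm_sum_sq_orthogonal)
      (simp add: qinner_scaleQ_left qinner_scaleQ_right \<xi>_orthogonal)
  have "(\<Sum>k<n. (norm (?f k))\<^sup>2) \<le> (norm u)\<^sup>2" for n
    using norm_proj_sq [of u n] pyth [of "{..<n}"] by (simp add: proj_def)
  then have sm: "summable (\<lambda>k. (norm (?f k))\<^sup>2)"
    by (intro summableI_nonneg_bounded) simp_all
  have "summable ?f"
    unfolding summable_Cauchy
  proof (intro allI impI)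
    fix e :: real assume "0 < e"
    then obtain m where m: "\<And>i j. m \<le> i \<Longrightarrow> norm (\<Sum>k=i..<j. (norm (?f k))\<^sup>2) < e\<^sup>2"
      using sm unfolding summable_Cauchy by (meson zero_less_power)
    have "norm (sum ?f {i..<j}) < e" if "m \<le> i" for i j
    proof (rule power_less_imp_less_base)
      show "(norm (sum ?f {i..<j}))\<^sup>2 < e\<^sup>2"
        using m [OF that, of j] pyth [of "{i..<j}"] by simp
    qed (use \<open>0 < e\<close> in simp)
    then show "\<exists>m. \<forall>i\<ge>m. \<forall>j. norm (sum ?f {i..<j}) < e"
      by blast
  qed
  then show ?thesis
    unfolding summable_iff_convergent proj_def .
qed

lemma \<xi>_orthonormal_inj:
  "inj_on \<xi> {k. \<xi> k \<noteq> 0}" "qorthonormal (\<xi> ` {k. \<xi> k \<noteq> 0})"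
proof -
  have self: "qinner (\<xi> k) (\<xi> k) = 1" if "\<xi> k \<noteq> 0" for k
    using that unit_or_zero [of k] by (simp add: qinner_self)
  show "inj_on \<xi> {k. \<xi> k \<noteq> 0}"
    using self \<xi>_orthogonal by (metis (mono_tags) inj_onI mem_Collect_eq zero_neq_one)
  then show "qorthonormal (\<xi> ` {k. \<xi> k \<noteq> 0})"
    using self by (auto simp: qorthonormal_def intro!: \<xi>_orthogonal)
qed

lemma proj_in_qspan: "proj n u \<in> qspan (\<xi> ` {k. \<xi> k \<noteq> 0})"
proof -
  let ?F = "{k. k < n \<and> \<xi> k \<noteq> 0}"
  have "proj n u = (\<Sum>k\<in>?F. qinner u (\<xi> k) *\<^sub>Q \<xi> k)"
    unfolding proj_def by (rule sum.mono_neutral_right) (auto simp: scaleQ.zero_right)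
  also have "\<dots> = (\<Sum>x\<in>\<xi> ` ?F. qinner u x *\<^sub>Q x)"
    by (subst sum.reindex) (auto intro: inj_on_subset [OF \<xi>_orthonormal_inj(1)])
  finally have "proj n u = (\<Sum>x\<in>\<xi> ` ?F. qinner u x *\<^sub>Q x)" .
  then show ?thesis
    unfolding qspan_def by (intro CollectI exI [of _ "\<xi> ` ?F"] exI [of _ "qinner u"]) auto
qed

text \<open>The limit \<open>p\<close> of the projections of \<open>u\<close> satisfies \<open>T p = T u\<close>, and \<open>T\<close> is injective.\<close>

lemma \<xi>_orthonormal_basis:
  assumes "\<not> qeigenvalue T 0"
  shows "qorthonormal_basis (\<xi> ` {k. \<xi> k \<noteq> 0})"
proof -
  have "u \<in> closure (qspan (\<xi> ` {k. \<xi> k \<noteq> 0}))" for u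
  proof -
    obtain p where p: "(\<lambda>n. proj n u) \<longlonglongrightarrow> p"
      using proj_convergent by (auto simp: convergent_def)
    then have "T p = T u"
      using T_proj_tendsto T.tendsto LIMSEQ_unique by blast
    then have "T (u - p) = 0 *\<^sub>Q (u - p)"
      by (simp add: T.diff scaleQ_zero_left)
    then have "p = u"
      using assms unfolding qeigenvalue_def by (metis right_minus_eq)
    then show ?thesis
      unfolding closure_sequential
      by (intro exI [of _ "\<lambda>n. proj n u"] conjI allI proj_in_qspan) (use p in simp)
  qed
  then show ?thesis
    using \<xi>_orthonormal_inj by (auto simp: qorthonormal_basis_def)
qed

end

lemma enat_length_of_initial_segment:
  fixes P :: "nat \<Rightarrow> bool"
  assumes "\<And>m n. m \<le> n \<Longrightarrow> P n \<Longrightarrow> P m"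
  obtains N where "\<And>k. enat k < N \<longleftrightarrow> P k"
proof (cases "\<forall>k. P k")
  case True
  then show ?thesis
    using that [of \<infinity>] by simp
next
  case False
  then obtain n where n: "\<not> P n" "\<And>k. k < n \<Longrightarrow> P k"
    using exists_least_iff [of "\<lambda>k. \<not> P k"] by blast
  have "enat k < enat n \<longleftrightarrow> P k" for k
    unfolding enat_ord_simps using n assms by (metis not_le)
  then show ?thesis
    using that by blast
qed

section \<open>The spectral theorem\<close>

theorem theorem3p12:
  fixes T :: "'a::quat_hilbert \<Rightarrow> 'a"
  assumes "bounded_qlinear T" and "compact_op T" and "normal_op T"
  defines "K \<equiv> T \<circ> qadjoint T"
  shows "\<exists>(N :: enat) (l :: nat \<Rightarrow> quat) (\<xi> :: nat \<Rightarrow> 'a).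
    (\<forall>j k. j \<le> k \<and> enat k < N \<longrightarrow> norm (l k) \<le> norm (l j)) \<and>
    (\<forall>k. enat k < N \<longrightarrow> norm (\<xi> k) = 1) \<and>
    (\<forall>k. enat k < N \<longrightarrow> qeigenvalue T (l k)) \<and>
    (N = \<infinity> \<longrightarrow> (\<lambda>k. norm (l k)) \<longlonglongrightarrow> 0) \<and>
    (\<forall>k. enat k < N \<longrightarrow> T (\<xi> k) = l k *\<^sub>Q \<xi> k \<and>
                        K (\<xi> k) = of_real ((norm (l k))\<^sup>2) *\<^sub>Q \<xi> k) \<and>
    (\<forall>u. (\<lambda>k. if enat k < N then qinner u (\<xi> k) *\<^sub>Q l k *\<^sub>Q \<xi> k else 0) sums T u \<and>
         (\<lambda>k. if enat k < N then qinner u (\<xi> k) *\<^sub>Q of_real ((norm (l k))\<^sup>2) *\<^sub>Q \<xi> k else 0) sums K u) \<and>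
    (\<not> qeigenvalue T 0 \<longrightarrow>
       inj_on \<xi> {k. enat k < N} \<and> qorthonormal_basis (\<xi> ` {k. enat k < N}))"
proof -
  interpret compact_normal T "qadjoint T"
  proof
    show "bounded_qlinear T" "compact_op T"
      by fact+
    show "bounded_qlinear (qadjoint T)" "qinner (T u) v = qinner u (qadjoint T v)" for u v
      using \<open>bounded_qlinear T\<close> by (rule qadjoint)+
    show "T (qadjoint T u) = qadjoint T (T u)" for u
      using \<open>normal_op T\<close> unfolding normal_op_def by (metis comp_apply)
  qed
  obtain \<xi> l where "eigensequence T (qadjoint T) \<xi> l"
    using eigensequence_exists by blast
  then interpret eigensequence T "qadjoint T" \<xi> l .
  obtain N where N: "\<And>k. enat k < N \<longleftrightarrow> \<xi> k \<noteq> 0"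
    using enat_length_of_initial_segment [of "\<lambda>k. \<xi> k \<noteq> 0"] \<xi>_eq_0_mono by blast
  have T_sums: "(\<lambda>k. if \<xi> k \<noteq> 0 then qinner u (\<xi> k) *\<^sub>Q l k *\<^sub>Q \<xi> k else 0) sums T u" for u
    by (rule sums_cong [THEN iffD1, OF _ T_expansion]) (simp add: scaleQ.zero_right)
  have K_sums: "(\<lambda>k. if \<xi> k \<noteq> 0
      then qinner u (\<xi> k) *\<^sub>Q of_real ((norm (l k))\<^sup>2) *\<^sub>Q \<xi> k else 0) sums K u" for u
    unfolding K_def o_def
    by (rule sums_cong [THEN iffD1, OF _ K_expansion]) (simp add: scaleQ.zero_right)
  show ?thesis
  proof (rule exI [of _ N], rule exI [of _ l], rule exI [of _ \<xi>], unfold N, intro conjI allI impI)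
    show "norm (l k) \<le> norm (l j)" if "j \<le> k \<and> \<xi> k \<noteq> 0" for j k
      using that by (intro decseqD [OF norm_l_decseq]) simp
    show "norm (\<xi> k) = 1" "qeigenvalue T (l k)" if "\<xi> k \<noteq> 0" for k
      using that unit_or_zero [of k] T_\<xi> by (auto simp: qeigenvalue_def)
    show "K (\<xi> k) = of_real ((norm (l k))\<^sup>2) *\<^sub>Q \<xi> k" for k
      unfolding K_def o_def by (rule K_\<xi>)
  qed (rule norm_l_tendsto_0 T_\<xi> T_sums K_sums \<xi>_orthonormal_inj(1) \<xi>_orthonormal_basis, assumption?)+
qed

end
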